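(* Let $0<k\in\mathbb{Z}$ and $n=2k+1$. The graph $R_k$ is a quotient graph of the middle-levels graph $M_k$ under an action $\Upsilon:D_{2n}\times M_k\rightarrow M_k$ of the dihedral group $D_{2n}$ of order $2n$.
   Context: Let $n=2k+1$. $M_k$ is the graph whose vertices are the binary $n$-strings $b_0b_1\cdots b_{n-1}$ of weight $k$ (set $L_k$) or weight $k+1$ (set $L_{k+1}$) (equivalently the $k$- and $(k+1)$-subsets of $\{0,\ldots,2k\}$ via characteristic vectors), two of them being adjacent iff they differ in exactly one entry. For a set $A\subseteq\{0,\ldots,2k\}$, $B_A$ denotes its characteristic string. $\mathbb{Z}_n$ acts on $M_k$ by cyclic translation of coordinates mod $n$. $M_k/\pi$ is the quotient (multi)graph: its vertices are the classes $(b_0\cdots b_{n-1})$ of vertices of $M_k$ under translation and its edges are the classes of edges of $M_k$ under translation. The complemented reversal $\aleph$, $\aleph(b_0b_1\cdots b_{2k})=\bar b_{2k}\cdots\bar b_1\bar b_0$ (with $\bar0=1,\bar1=0$), is an involution of $M_k$ exchanging $L_k$ and $L_{k+1}$, and it induces an involution $\aleph_\pi$ of $M_k/\pi$. An edge of $M_k/\pi$ is horizontal if it joins some class $v$ to $\aleph_\pi(v)$; otherwise it is skew. $R_k$ is the graph (with loops allowed) whose vertices are the pairs $\langle B_A\rangle=\{(B_A),\aleph_\pi((B_A))\}$ with $|A|=k$, having: (1) an edge $\langle B_A\rangle\langle B_{A'}\rangle$ for each pair of skew edges $\{(B_A)\aleph_\pi((B_{A'})),(B_{A'})\aleph_\pi((B_A))\}$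 of $M_k/\pi$ exchanged by $\aleph_\pi$; (2) a loop at $\langle B_A\rangle$ for each horizontal edge $(B_A)\aleph_\pi((B_A))$ of $M_k/\pi$ (counted with multiplicity). The quotient graph of $M_k$ under a group action by automorphisms has as vertices the vertex orbits and as edges (or loops) the edge orbits. *)

theory Defs
  imports "HOL-Algebra.Group_Action" "HOL-Algebra.Elementary_Groups"
begin

section \<open>Multigraphs and quotients by group actions\<close>

text \<open>Undirected multigraphs with loops: an edge \<open>e\<close> is incident with the one (loop) or two
  vertices in \<open>ends \<Gamma> e\<close>; parallel edges are different elements with the same ends.\<close>

record ('v, 'e) mgraph =
  verts :: "'v set"
  edges :: "'e set"
  ends :: "'e \<Rightarrow> 'v set"

definition mgraph_iso :: "('v, 'e) mgraph \<Rightarrow> ('w, 'f) mgraph \<Rightarrow> bool" where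
  "mgraph_iso \<Gamma> \<Delta> \<longleftrightarrow>
     (\<exists>f g. bij_betw f (verts \<Gamma>) (verts \<Delta>) \<and> bij_betw g (edges \<Gamma>) (edges \<Delta>) \<and>
            (\<forall>e\<in>edges \<Gamma>. ends \<Delta> (g e) = f ` ends \<Gamma> e))"

text \<open>Simple graphs are represented by taking an edge to be its set of ends. For these, an action
  is given by its effect on the vertices, and an edge \<open>e\<close> is mapped to \<open>\<phi> g ` e\<close>.\<close>

definition simple_mgraph :: "'v set \<Rightarrow> ('v \<Rightarrow> 'v \<Rightarrow> bool) \<Rightarrow> ('v, 'v set) mgraph" where
  "simple_mgraph V adj =
     \<lparr>verts = V, edges = {{u, v} | u v. u \<in> V \<and> v \<in> V \<and> adj u v}, ends = (\<lambda>e. e)\<rparr>"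

definition acts_on_graph ::
    "('a, 'm) monoid_scheme \<Rightarrow> ('v, 'v set) mgraph \<Rightarrow> ('a \<Rightarrow> 'v \<Rightarrow> 'v) \<Rightarrow> bool" where
  "acts_on_graph G \<Gamma> \<phi> \<longleftrightarrow>
     group_action G (verts \<Gamma>) \<phi> \<and>
     (\<forall>g\<in>carrier G. \<forall>u\<in>verts \<Gamma>. \<forall>v\<in>verts \<Gamma>.
        {\<phi> g u, \<phi> g v} \<in> edges \<Gamma> \<longleftrightarrow> {u, v} \<in> edges \<Gamma>)"

definition quotient_graph ::
    "('a, 'm) monoid_scheme \<Rightarrow> ('a \<Rightarrow> 'v \<Rightarrow> 'v) \<Rightarrow> ('v, 'v set) mgraph \<Rightarrow>
     ('v set, 'v set set) mgraph" where
  "quotient_graph G \<phi> \<Gamma> =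
     \<lparr>verts = orbits G (verts \<Gamma>) \<phi>,
      edges = orbits G (edges \<Gamma>) (\<lambda>g e. \<phi> g ` e),
      ends = (\<lambda>\<epsilon>. {orbit G \<phi> v | v e. e \<in> \<epsilon> \<and> v \<in> e})\<rparr>"

section \<open>The dihedral group\<close>

text \<open>The dihedral group of order \<open>2 * n\<close> as the semidirect product of the integers modulo \<open>n\<close>
  with a group of order two acting by inversion: \<open>(i, False)\<close> is the rotation \<open>r\<^sup>i\<close> and
  \<open>(i, True)\<close> is the reflection \<open>r\<^sup>i s\<close>, where \<open>s r s = r\<^sup>-\<^sup>1\<close>.\<close>

definition dihedral_group :: "nat \<Rightarrow> (int \<times> bool) monoid" where
  "dihedral_group n =
     \<lparr>carrier = {0..<int n} \<times> UNIV,
      monoid.mult = (\<lambda>(i, s) (j, t). ((if s then i - j else i + j) mod int n, s \<noteq> t)),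
      one = (0, False)\<rparr>"

lemma group_dihedral_group:
  assumes "n > 0"
  shows "group (dihedral_group n)"
proof (rule groupI)
  fix x assume "x \<in> carrier (dihedral_group n)"
  then obtain i s where x: "x = (i, s)" "0 \<le> i" "i < int n"
    by (auto simp: dihedral_group_def)
  show "\<exists>y\<in>carrier (dihedral_group n). y \<otimes>\<^bsub>dihedral_group n\<^esub> x = \<one>\<^bsub>dihedral_group n\<^esub>"
    using x assms
    by (intro bexI[of _ "if s then x else ((- i) mod int n, False)"])
       (auto simp: dihedral_group_def mod_simps)
qed (use assms in \<open>auto simp: dihedral_group_def mod_simps algebra_simps\<close>)

lemma order_dihedral_group: "order (dihedral_group n) = 2 * n"
  by (simp add: order_def dihedral_group_def card_cartesian_product)

section \<open>The middle-levels graph and its reduction\<close>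

definition weight :: "bool list \<Rightarrow> nat" where
  "weight b = card {i. i < length b \<and> b ! i}"

definition level :: "nat \<Rightarrow> nat \<Rightarrow> bool list set" where
  "level n w = {b. length b = n \<and> weight b = w}"

definition middle_levels :: "nat \<Rightarrow> (bool list, bool list set) mgraph" where
  "middle_levels k =
     simple_mgraph (level (2 * k + 1) k \<union> level (2 * k + 1) (k + 1))
       (\<lambda>u v. card {i. i < 2 * k + 1 \<and> u ! i \<noteq> v ! i} = 1)"

definition char_string :: "nat \<Rightarrow> nat set \<Rightarrow> bool list" where
  "char_string k A = map (\<lambda>i. i \<in> A) [0..<2 * k + 1]"

definition k_subsets :: "nat \<Rightarrow> nat set set" where
  "k_subsets k = {A. A \<subseteq> {0..2 * k} \<and> card A = k}"

definition translation :: "nat \<Rightarrow> int \<Rightarrow> bool list \<Rightarrow> bool list" where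
  "translation k j = (\<lambda>b \<in> verts (middle_levels k). rotate (nat j) b)"

definition cyclic_quotient :: "nat \<Rightarrow> (bool list set, bool list set set) mgraph" where
  "cyclic_quotient k =
     quotient_graph (integer_mod_group (2 * k + 1)) (translation k) (middle_levels k)"

definition cyclic_class :: "nat \<Rightarrow> bool list \<Rightarrow> bool list set" where
  "cyclic_class k b = orbit (integer_mod_group (2 * k + 1)) (translation k) b"

definition aleph :: "bool list \<Rightarrow> bool list" where
  "aleph b = map Not (rev b)"

definition aleph_class :: "bool list set \<Rightarrow> bool list set" where
  "aleph_class c = aleph ` c"

definition aleph_edge_class :: "bool list set set \<Rightarrow> bool list set set" where
  "aleph_edge_class \<epsilon> = (\<lambda>e. aleph ` e) ` \<epsilon>"

definition horizontal_edges :: "nat \<Rightarrow> bool list set set set" where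
  "horizontal_edges k =
     {\<epsilon> \<in> edges (cyclic_quotient k).
        \<exists>v\<in>verts (cyclic_quotient k). ends (cyclic_quotient k) \<epsilon> = {v, aleph_class v}}"

definition skew_edges :: "nat \<Rightarrow> bool list set set set" where
  "skew_edges k = edges (cyclic_quotient k) - horizontal_edges k"

definition set_class :: "nat \<Rightarrow> nat set \<Rightarrow> bool list set" where
  "set_class k A = cyclic_class k (char_string k A)"

definition class_pair :: "nat \<Rightarrow> nat set \<Rightarrow> bool list set set" where
  "class_pair k A = {set_class k A, aleph_class (set_class k A)}"

definition skew_pairs :: "nat \<Rightarrow> bool list set set set set" where
  "skew_pairs k =
     {{\<epsilon>, aleph_edge_class \<epsilon>} | \<epsilon> A A'.
        \<epsilon> \<in> skew_edges k \<and> A \<in> k_subsets k \<and> A' \<in> k_subsets k \<and>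
        ends (cyclic_quotient k) \<epsilon> = {set_class k A, aleph_class (set_class k A')}}"

text \<open>The edges of the reduced graph are the pairs of skew edges (\<open>Inl\<close>) and the horizontal edges
  (\<open>Inr\<close>). If a pair consists of an edge with ends \<open>(B\<^sub>A)\<close>, \<open>\<aleph>(B\<^sub>A\<^sub>')\<close> and an edge with ends
  \<open>(B\<^sub>A\<^sub>')\<close>, \<open>\<aleph>(B\<^sub>A)\<close>, then the classes of weight \<open>k\<close> among these four are \<open>(B\<^sub>A)\<close> and \<open>(B\<^sub>A\<^sub>')\<close>.\<close>

definition reduced_graph ::
    "nat \<Rightarrow> (bool list set set, bool list set set set + bool list set set) mgraph" where
  "reduced_graph k =
     \<lparr>verts = class_pair k ` k_subsets k,
      edges = Inl ` skew_pairs k \<union> Inr ` horizontal_edges k,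
      ends = (\<lambda>x. case x of
          Inl P \<Rightarrow> {class_pair k A | A. A \<in> k_subsets k \<and>
                     (\<exists>\<epsilon>\<in>P. set_class k A \<in> ends (cyclic_quotient k) \<epsilon>)}
        | Inr \<epsilon> \<Rightarrow> {class_pair k A | A. A \<in> k_subsets k \<and>
                     set_class k A \<in> ends (cyclic_quotient k) \<epsilon>})\<rparr>"

end

theory Submission
  imports Defs
begin

text \<open>Let \<open>D\<^sub>2\<^sub>n\<close> act by \<open>r\<^sup>i \<mapsto>\<close> translation by \<open>i\<close> and \<open>s \<mapsto> \<aleph>\<close>. A \<open>D\<^sub>2\<^sub>n\<close>-orbit is the union of a
  cyclic class and its image under \<open>\<aleph>\<close>, so orbits of vertices correspond to the pairs
  \<open>\<langle>B\<^sub>A\<rangle>\<close>, and orbits of edges to the sets \<open>{\<epsilon>, \<aleph>\<^sub>\<pi> \<epsilon>}\<close>. The point to check is that \<open>\<aleph>\<^sub>\<pi>\<close> fixes every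
  horizontal edge: if \<open>{u, w}\<close> is an edge with \<open>w = r\<^sup>i (\<aleph> u)\<close>, then the reflection \<open>r\<^sup>i s\<close> is an
  involution, hence it exchanges \<open>u\<close> and \<open>w\<close> and fixes the edge.\<close>

section \<open>Orbits of a rotation and a reflection\<close>

text \<open>Strings and edges both obey these laws, so orbits are computed once for both. Rotation
  amounts are natural numbers, hence the inverse of \<open>\<rho> m\<close> appears as
  \<open>\<rho> (n - m)\<close>, with \<open>m \<le> n\<close> to avoid truncated
  subtraction.\<close>

locale rotation_reflection =
  fixes X :: "'x set" and n :: nat and \<rho> :: "nat \<Rightarrow> 'x \<Rightarrow> 'x" and \<alpha> :: "'x \<Rightarrow> 'x"
  assumes n_pos: "n > 0"
    and rot_closed: "x \<in> X \<Longrightarrow> \<rho> m x \<in> X"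
    and refl_closed: "x \<in> X \<Longrightarrow> \<alpha> x \<in> X"
    and rot_0: "x \<in> X \<Longrightarrow> \<rho> 0 x = x"
    and rot_add: "x \<in> X \<Longrightarrow> \<rho> l (\<rho> m x) = \<rho> (l + m) x"
    and rot_n: "x \<in> X \<Longrightarrow> \<rho> n x = x"
    and refl_refl: "x \<in> X \<Longrightarrow> \<alpha> (\<alpha> x) = x"
    and refl_rot: "x \<in> X \<Longrightarrow> m \<le> n \<Longrightarrow> \<alpha> (\<rho> m x) = \<rho> (n - m) (\<alpha> x)"
begin

definition cyc :: "'x \<Rightarrow> 'x set" where
  "cyc x = range (\<lambda>m. \<rho> m x)"

definition dih :: "int \<times> bool \<Rightarrow> 'x \<Rightarrow> 'x" where
  "dih g x = \<rho> (nat (fst g)) (if snd g then \<alpha> x else x)"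

lemma rot_mult_n: "x \<in> X \<Longrightarrow> \<rho> (m * n) x = x"
proof (induction m)
  case (Suc m)
  then show ?case using rot_add[of x n "m * n"] by (simp add: rot_n)
qed (simp add: rot_0)

lemma rot_mod: "x \<in> X \<Longrightarrow> \<rho> (m mod n) x = \<rho> m x"
  by (metis mod_div_mult_eq rot_add rot_mult_n)

lemma cyc_eq: "x \<in> X \<Longrightarrow> cyc x = (\<lambda>m. \<rho> m x) ` {..<n}"
proof -
  assume "x \<in> X"
  then have "\<rho> m x \<in> (\<lambda>m. \<rho> m x) ` {..<n}" for m
    using n_pos by (intro image_eqI[of _ _ "m mod n"]) (auto simp: rot_mod)
  then show ?thesis by (auto simp: cyc_def)
qed

lemma cyc_self: "x \<in> X \<Longrightarrow> x \<in> cyc x"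
  unfolding cyc_def by (metis rangeI rot_0)

lemma cyc_subset: "x \<in> X \<Longrightarrow> cyc x \<subseteq> X"
  by (auto simp: cyc_def rot_closed)

lemma cyc_rot:
  assumes "x \<in> X" shows "cyc (\<rho> m x) = cyc x"
proof -
  \<comment> \<open>\<open>n - m mod n\<close> undoes rotation by \<open>m\<close>; reducing
    \<open>m\<close> first keeps the subtraction from truncating.\<close>
  have "\<rho> l x = \<rho> (l + (n - m mod n)) (\<rho> m x)" for l
  proof -
    have "\<rho> (l + (n - m mod n)) (\<rho> m x) = \<rho> (l + (n - m mod n)) (\<rho> (m mod n) x)"
      using assms by (simp add: rot_mod)
    also have "\<dots> = \<rho> (l + n) x"
      using assms mod_less_divisor[OF n_pos, of m] by (simp add: rot_add)
    also have "\<dots> = \<rho> l x" using assms by (simp add: rot_n flip: rot_add)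
    finally show ?thesis by simp
  qed
  then show ?thesis
    using assms by (auto simp: cyc_def rot_add)
qed

lemma cyc_cong: "x \<in> X \<Longrightarrow> y \<in> cyc x \<Longrightarrow> cyc y = cyc x"
  by (metis cyc_def cyc_rot imageE)

text \<open>One inclusion is \<open>refl_rot\<close> for \<open>m < n\<close>; the other follows by
  applying the first to \<open>\<alpha> x\<close>, since \<open>\<alpha>\<close> is an
  involution.\<close>

lemma refl_image_cyc:
  assumes "x \<in> X" shows "\<alpha> ` cyc x = cyc (\<alpha> x)"
proof -
  have sub: "\<alpha> ` cyc y \<subseteq> cyc (\<alpha> y)" if "y \<in> X" for y
  proof -
    have "\<alpha> (\<rho> m y) \<in> cyc (\<alpha> y)" if "m < n" for m
      using \<open>y \<in> X\<close> that by (simp add: refl_rot cyc_def)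
    then show ?thesis using that by (auto simp: cyc_eq)
  qed
  have "cyc (\<alpha> x) = \<alpha> ` \<alpha> ` cyc (\<alpha> x)"
    using cyc_subset[of "\<alpha> x"] assms refl_refl refl_closed by (force simp: image_iff)
  also have "\<dots> \<subseteq> \<alpha> ` cyc x"
    using sub[of "\<alpha> x"] assms by (auto simp: refl_refl refl_closed)
  finally show ?thesis using sub assms by blast
qed

text \<open>As \<alpha> inverts rotations, the two rotations cancel. This is
  \<open>(r^m s)^2 = 1\<close> in the dihedral group.\<close>

lemma reflection_involution:
  assumes "x \<in> X"
  shows "\<rho> m (\<alpha> (\<rho> m (\<alpha> x))) = x"
proof -
  have "\<rho> m (\<alpha> (\<rho> m (\<alpha> x))) = \<rho> (m mod n) (\<alpha> (\<rho> (m mod n) (\<alpha> x)))"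
    using assms by (simp add: rot_mod rot_closed refl_closed)
  also have "\<dots> = \<rho> (m mod n) (\<rho> (n - m mod n) x)"
    using assms n_pos refl_rot[of "\<alpha> x" "m mod n"] by (simp add: refl_closed refl_refl)
  also have "\<dots> = x"
    using assms n_pos by (simp add: rot_add rot_n)
  finally show ?thesis .
qed

lemma cyc_image_cyc:
  assumes "x \<in> X" shows "cyc ` cyc x = {cyc x}"
proof -
  have "cyc ` cyc x = range (\<lambda>m. cyc (\<rho> m x))"
    by (simp add: cyc_def[of x] image_image)
  then show ?thesis by (simp add: cyc_rot[OF assms])
qed

text \<open>\<open>cyc\<close> is constant on each cyclic orbit, so its image splits a dihedral
  orbit into its one or two cyclic ones.\<close>

lemma cyc_image_pair: "x \<in> X \<Longrightarrow> cyc ` (cyc x \<union> cyc (\<alpha> x)) = {cyc x, cyc (\<alpha> x)}"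
  by (simp add: image_Un cyc_image_cyc refl_closed insert_commute)

section \<open>Orbits and action of the cyclic and the dihedral group\<close>

text \<open>Agreement of \<open>\<phi>\<close> with rotation is asked only at \<open>x\<close>; this
  covers both \<open>translation\<close>, which is restricted to the vertices, and its effect on
  edges by images.\<close>

lemma orbit_integer_mod_group:
  assumes "x \<in> X" and "\<And>m. m < n \<Longrightarrow> \<phi> (int m) x = \<rho> m x"
  shows "orbit (integer_mod_group n) \<phi> x = cyc x"
proof -
  have "carrier (integer_mod_group n) = int ` {..<n}"
    using n_pos by (simp add: carrier_integer_mod_group image_int_atLeastLessThan lessThan_atLeast0)
  then have "orbit (integer_mod_group n) \<phi> x = (\<lambda>m. \<phi> (int m) x) ` {..<n}"
    by (auto simp: orbit_def)
  also have "\<dots> = (\<lambda>m. \<rho> m x) ` {..<n}"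
    using assms(2) by (intro image_cong) auto
  finally show ?thesis using assms(1) by (simp add: cyc_eq)
qed

lemma orbit_dihedral_group:
  assumes "x \<in> X" and "\<And>g. g \<in> carrier (dihedral_group n) \<Longrightarrow> \<phi> g x = dih g x"
  shows "orbit (dihedral_group n) \<phi> x = cyc x \<union> cyc (\<alpha> x)"
proof -
  have c: "carrier (dihedral_group n) = (\<lambda>(m, s). (int m, s)) ` ({..<n} \<times> UNIV)"
    by (auto simp: dihedral_group_def image_iff intro!: bexI[of _ "nat _"])
  have "orbit (dihedral_group n) \<phi> x = (\<lambda>g. \<phi> g x) ` carrier (dihedral_group n)"
    by (auto simp: orbit_def)
  also have "\<dots> = (\<lambda>g. dih g x) ` carrier (dihedral_group n)"
    using assms(2) by (rule image_cong[OF refl])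
  also have "\<dots> = (\<lambda>(m, s). \<rho> m (if s then \<alpha> x else x)) ` ({..<n} \<times> UNIV)"
    unfolding c image_image by (simp add: dih_def case_prod_unfold)
  also have "{..<n} \<times> (UNIV :: bool set) = (\<lambda>m. (m, False)) ` {..<n} \<union> (\<lambda>m. (m, True)) ` {..<n}"
    by (auto simp: UNIV_bool)
  also have "(\<lambda>(m, s). \<rho> m (if s then \<alpha> x else x)) ` \<dots> =
      (\<lambda>m. \<rho> m x) ` {..<n} \<union> (\<lambda>m. \<rho> m (\<alpha> x)) ` {..<n}"
    by (simp add: image_Un image_image)
  finally show ?thesis using assms by (simp add: cyc_eq refl_closed)
qed

lemma dih_mult:
  assumes x: "x \<in> X" and g: "g \<in> carrier (dihedral_group n)" and h: "h \<in> carrier (dihedral_group n)"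
  shows "dih (g \<otimes>\<^bsub>dihedral_group n\<^esub> h) x = dih g (dih h x)"
proof -
  obtain i s j t where gh: "g = (int i, s)" "h = (int j, t)" and lt: "i < n" "j < n"
    using g h by (auto simp: dihedral_group_def elim!: nonneg_int_cases)
  define y where "y = (if t then \<alpha> x else x)"
  have y: "y \<in> X" "\<alpha> y \<in> X" using x by (auto simp: y_def refl_closed)
  show ?thesis
  proof (cases s)
    case True
    have "dih (g \<otimes>\<^bsub>dihedral_group n\<^esub> h) x = \<rho> (nat ((int i - int j) mod int n)) (\<alpha> y)"
      using gh True x by (auto simp: dih_def dihedral_group_def y_def refl_refl)
    \<comment> \<open>The group subtracts integers, but rotation amounts are naturals:
      \<open>i - j\<close> is congruent to \<open>i + (n - j)\<close>, where
      \<open>j < n\<close>.\<close>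
    also have "(int i - int j) mod int n = int ((i + (n - j)) mod n)"
    proof -
      have "int i - int j = int (i + (n - j)) - int n" using lt by simp
      then have "(int i - int j) mod int n = int (i + (n - j)) mod int n" 
        by (simp only: minus_mod_self2)
      then show ?thesis by (simp only: zmod_int)
    qed
    also have "\<rho> (nat (int ((i + (n - j)) mod n))) (\<alpha> y) = \<rho> i (\<rho> (n - j) (\<alpha> y))"
      using y by (simp add: rot_mod rot_add)
    also have "\<dots> = \<rho> i (\<alpha> (\<rho> j y))" using y lt by (simp add: refl_rot)
    finally show ?thesis using gh True by (simp add: dih_def y_def)
  next
    case False
    have "dih (g \<otimes>\<^bsub>dihedral_group n\<^esub> h) x = \<rho> (nat (int ((i + j) mod n))) y"
      using gh False by (simp add: dih_def dihedral_group_def y_def zmod_int)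
    then show ?thesis using gh False y by (simp add: dih_def rot_mod rot_add y_def)
  qed
qed

lemma dih_closed: "x \<in> X \<Longrightarrow> dih g x \<in> X"
  by (simp add: dih_def rot_closed refl_closed)

lemma group_action_dih: "group_action (dihedral_group n) X (\<lambda>g. restrict (dih g) X)"
proof -
  interpret G: group "dihedral_group n" by (rule group_dihedral_group[OF n_pos])
  have one: "dih \<one>\<^bsub>dihedral_group n\<^esub> x = x" if "x \<in> X" for x
    using that by (simp add: dih_def dihedral_group_def rot_0)
  \<comment> \<open>The inverse group element yields a two-sided inverse map; restricting to
    \<open>X\<close> supplies the extensionality that \<open>Bij X\<close> demands.\<close>
  have Bij: "restrict (dih g) X \<in> Bij X" if g: "g \<in> carrier (dihedral_group n)" for g
  proof -
    have "dih (inv\<^bsub>dihedral_group n\<^esub> g) (dih g x) = x" "dih g (dih (inv\<^bsub>dihedral_group n\<^esub> g) x) = x"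
      if "x \<in> X" for x
      using that g one by (metis dih_mult G.inv_closed G.l_inv, metis dih_mult G.inv_closed G.r_inv)
    then have "bij_betw (dih g) X X"
      by (intro bij_betw_byWitness[of _ "dih (inv\<^bsub>dihedral_group n\<^esub> g)"])
         (auto simp: dih_closed)
    then show ?thesis by (simp add: Bij_def)
  qed
  have "(\<lambda>g. restrict (dih g) X) \<in> hom (dihedral_group n) (BijGroup X)"
    using Bij by (intro homI) (auto simp: BijGroup_def compose_def dih_mult dih_closed fun_eq_iff)
  then show ?thesis
    unfolding group_action_def group_hom_def group_hom_axioms_def
    by (simp add: G.is_group group_BijGroup)
qed

end

section \<open>Translation and complemented reversal of strings\<close>

text \<open>Recording disagreements as a string turns adjacency into weight one, so invariance of
  edges reduces to invariance of the weight under rotation and reversal.\<close>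

definition mismatch :: "bool list \<Rightarrow> bool list \<Rightarrow> bool list" where
  "mismatch u v = map2 (\<noteq>) u v"

lemma weight_conv_filter: "weight b = length (filter (\<lambda>x. x) b)"
  by (simp add: weight_def length_filter_conv_card)

lemma weight_rotate: "weight (rotate m b) = weight b"
proof (induction m)
  case (Suc m)
  have "weight (rotate1 c) = weight c" for c
    by (cases c) (auto simp: weight_conv_filter)
  then show ?case using Suc by simp
qed simp

lemma length_aleph: "length (aleph b) = length b"
  by (simp add: aleph_def)

lemma aleph_aleph: "aleph (aleph b) = b"
  by (simp add: aleph_def rev_map o_def)

text \<open>Reversal keeps the number of ones and complementing trades ones for zeros; for length
  \<open>2 * k + 1\<close> this exchanges the weights \<open>k\<close> and
  \<open>k + 1\<close>.\<close>

lemma weight_aleph: "weight (aleph b) = length b - weight b"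
  using sum_length_filter_compl[of "\<lambda>x. x" b]
  by (simp add: weight_conv_filter aleph_def filter_map o_def flip: rev_filter)

lemma aleph_rotate:
  assumes "m \<le> length b"
  shows "aleph (rotate m b) = rotate (length b - m) (aleph b)"
\<comment> \<open>\<open>rotate_rev\<close> reduces the rotation amount modulo the length, so the
  two extreme values, where both rotations are trivial, are treated apart.\<close>
proof (cases "m = 0 \<or> m = length b")
  case True
  then show ?thesis using rotate_id[of "length b" "aleph b"] by (auto simp: length_aleph)
next
  case False
  then have "(length b - m) mod length b = length b - m" "length b - (length b - m) = m"
    using assms by auto
  then show ?thesis by (simp only: aleph_def rotate_map rotate_rev)
qed

lemma card_mismatch:
  assumes "length u = n" "length v = n"
  shows "card {i. i < n \<and> u ! i \<noteq> v ! i} = weight (mismatch u v)"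
proof -
  have "{i. i < n \<and> u ! i \<noteq> v ! i} = {i. i < length (mismatch u v) \<and> mismatch u v ! i}"
    using assms by (auto simp: mismatch_def)
  then show ?thesis by (simp add: weight_def)
qed

lemma mismatch_rotate:
  "length u = length v \<Longrightarrow> mismatch (rotate m u) (rotate m v) = rotate m (mismatch u v)"
proof (rule nth_equalityI)
  fix i assume uv: "length u = length v" and "i < length (mismatch (rotate m u) (rotate m v))"
  then have i: "i < length v" by (simp add: mismatch_def)
  then have "(m + i) mod length v < length v" by (intro mod_less_divisor) auto
  then show "mismatch (rotate m u) (rotate m v) ! i = rotate m (mismatch u v) ! i"
    using uv i by (simp add: mismatch_def nth_rotate)
qed (simp add: mismatch_def)

lemma mismatch_aleph:
  "length u = length v \<Longrightarrow> mismatch (aleph u) (aleph v) = rev (mismatch u v)"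
  by (rule nth_equalityI) (auto simp: mismatch_def aleph_def rev_nth)

lemma weight_rev: "weight (rev b) = weight b"
  by (simp add: weight_conv_filter flip: rev_filter)

section \<open>The middle-levels graph\<close>

context
  fixes k :: nat
begin

declare One_nat_def [simp del]

private abbreviation (input) "N \<equiv> 2 * k + 1"
private abbreviation (input) "V \<equiv> verts (middle_levels k)"
private abbreviation (input) "E \<equiv> edges (middle_levels k)"

section \<open>Vertices, edges and levels\<close>

lemma V_iff: "b \<in> V \<longleftrightarrow> length b = N \<and> (weight b = k \<or> weight b = k + 1)"
  by (auto simp: middle_levels_def simple_mgraph_def level_def)

lemma edge_iff: "{u, v} \<in> E \<longleftrightarrow> u \<in> V \<and> v \<in> V \<and> weight (mismatch u v) = 1"
proof -
  define adj where "adj = (\<lambda>x y :: bool list. card {i. i < N \<and> x ! i \<noteq> y ! i} = 1)"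
  have "{i. i < N \<and> x ! i \<noteq> y ! i} = {i. i < N \<and> y ! i \<noteq> x ! i}" for x y :: "bool list"
    by auto
  then have sym: "adj x y = adj y x" for x y
    unfolding adj_def by metis
  have "E = {{x, y} | x y. x \<in> V \<and> y \<in> V \<and> adj x y}"
    by (simp add: middle_levels_def simple_mgraph_def adj_def)
  then have "{u, v} \<in> E \<longleftrightarrow> u \<in> V \<and> v \<in> V \<and> adj u v"
    using sym[of u v] by (auto simp: doubleton_eq_iff)
  moreover have "adj u v \<longleftrightarrow> weight (mismatch u v) = 1" if "u \<in> V" "v \<in> V"
    using that card_mismatch[of u N v] by (simp only: adj_def V_iff)
  ultimately show ?thesis by blast
qed

lemma edgeE:
  assumes "e \<in> E"
  obtains u w where "e = {u, w}" "u \<in> V" "w \<in> V" "weight (mismatch u w) = 1"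
proof -
  obtain u w where "e = {u, w}"
    using assms by (auto simp: middle_levels_def simple_mgraph_def)
  with assms show ?thesis by (metis edge_iff that)
qed

text \<open>The additive form avoids subtraction of naturals when a one is turned off.\<close>

lemma weight_list_update:
  assumes "i < length b"
  shows "weight (b[i := x]) + (if b ! i then 1 else 0) = weight b + (if x then 1 else 0)"
  using assms
proof (induction b arbitrary: i)
  case (Cons a b)
  show ?case
  proof (cases i)
    case 0
    then show ?thesis by (simp add: weight_conv_filter)
  next
    case (Suc j)
    then show ?thesis
      using Cons.IH[of j] Cons.prems by (auto simp: weight_conv_filter split: if_splits)
  qed
qed simp

lemma mismatch_one_update:
  assumes "length u = length v" "weight (mismatch u v) = 1"
  obtains i where "i < length u" "v = u[i := \<not> u ! i]"
proof -
  have "card {i. i < length u \<and> u ! i \<noteq> v ! i} = 1"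
    using card_mismatch[OF refl assms(1)[symmetric]] assms(2) by simp
  then obtain i where "{i. i < length u \<and> u ! i \<noteq> v ! i} = {i}"
    by (rule card_1_singletonE)
  then have i: "j < length u \<and> u ! j \<noteq> v ! j \<longleftrightarrow> j = i" for j
    unfolding set_eq_iff mem_Collect_eq singleton_iff by (rule spec)
  have "v ! j = u[i := \<not> u ! i] ! j" if "j < length v" for j
  proof (cases "j = i")
    case True
    then show ?thesis using i[of i] by auto
  next
    case False
    then show ?thesis using i[of j] that assms(1) by auto
  qed
  then have "v = u[i := \<not> u ! i]"
    using assms(1) by (intro nth_equalityI) simp_all
  then show ?thesis using that[of i] i[of i] by blast
qed

text \<open>Flipping one entry changes the weight by one, so no edge lies inside a level and its
  ends can be named by level.\<close>

lemma edge_levelsE: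
  assumes "e \<in> E"
  obtains u w where "e = {u, w}" "u \<in> V" "w \<in> V" "weight u = k" "weight w = k + 1"
proof -
  obtain u w where uw: "e = {u, w}" "u \<in> V" "w \<in> V" "weight (mismatch u w) = 1"
    using assms by (rule edgeE)
  then obtain i where "i < length u" "w = u[i := \<not> u ! i]"
    using mismatch_one_update by (metis V_iff)
  then have "weight u \<noteq> weight w"
    using weight_list_update[of i u "\<not> u ! i"] by (auto split: if_splits)
  then have "weight u = k \<and> weight w = k + 1 \<or> weight w = k \<and> weight u = k + 1"
    using uw by (auto simp: V_iff)
  then show ?thesis using that uw by (metis insert_commute)
qed

lemma edge_subset: "e \<in> E \<Longrightarrow> e \<subseteq> V"
  by (erule edgeE) simp

section \<open>Rotation and complemented reversal as automorphisms\<close>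

lemma rotate_V: "b \<in> V \<Longrightarrow> rotate m b \<in> V"
  by (simp add: V_iff weight_rotate)

lemma aleph_V: "b \<in> V \<Longrightarrow> aleph b \<in> V"
  by (auto simp: V_iff weight_aleph length_aleph)

lemma edge_rotate_iff:
  assumes "u \<in> V" "v \<in> V"
  shows "{rotate m u, rotate m v} \<in> E \<longleftrightarrow> {u, v} \<in> E"
  using assms by (simp add: edge_iff rotate_V mismatch_rotate weight_rotate V_iff)

lemma edge_aleph_iff:
  assumes "u \<in> V" "v \<in> V"
  shows "{aleph u, aleph v} \<in> E \<longleftrightarrow> {u, v} \<in> E"
proof -
  have "mismatch (aleph u) (aleph v) = rev (mismatch u v)"
    using assms by (simp add: mismatch_aleph V_iff)
  then show ?thesis using assms by (simp add: edge_iff aleph_V weight_rev)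
qed

interpretation S: rotation_reflection V N rotate aleph
proof unfold_locales
  fix b m assume b: "b \<in> V"
  then have len: "length b = N" by (simp add: V_iff)
  show "rotate N b = b" using rotate_id[of N b] len by simp
  show "aleph (rotate m b) = rotate (N - m) (aleph b)" if "m \<le> N"
    using that aleph_rotate[of m b] len by simp
qed (simp_all add: rotate_V aleph_V rotate_rotate aleph_aleph)

text \<open>Both operations act elementwise, so each law for an edge follows from the laws for its
  two ends.\<close>

interpretation T: rotation_reflection E N "\<lambda>m. (`) (rotate m)" "(`) aleph"
proof unfold_locales
  fix e m l assume e: "e \<in> E"
  obtain u w where uw: "e = {u, w}" "u \<in> V" "w \<in> V" using e by (rule edgeE)
  show "rotate m ` e \<in> E" "aleph ` e \<in> E"
    using e uw by (auto simp: edge_rotate_iff edge_aleph_iff)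
  show "rotate 0 ` e = e" "rotate N ` e = e" "rotate l ` rotate m ` e = rotate (l + m) ` e"
    "aleph ` aleph ` e = e"
    using uw by (auto simp: S.rot_add S.rot_0 S.rot_n S.refl_refl)
  show "aleph ` rotate m ` e = rotate (N - m) ` aleph ` e" if "m \<le> N"
    using uw S.refl_rot[OF _ that] by auto
qed simp

private abbreviation (input) action :: "int \<times> bool \<Rightarrow> bool list \<Rightarrow> bool list" where
  "action g \<equiv> restrict (S.dih g) V"

lemma acts_dih: "acts_on_graph (dihedral_group N) (middle_levels k) action"
  unfolding acts_on_graph_def
  by (auto simp: S.group_action_dih S.dih_def edge_rotate_iff edge_aleph_iff aleph_V)

lemma orbit_translation: "b \<in> V \<Longrightarrow> orbit (integer_mod_group N) (translation k) b = S.cyc b"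
  by (rule S.orbit_integer_mod_group) (auto simp: translation_def)

lemma orbit_translation_edge:
  assumes "e \<in> E"
  shows "orbit (integer_mod_group N) (\<lambda>g e. translation k g ` e) e = T.cyc e"
proof (rule T.orbit_integer_mod_group[OF assms])
  show "translation k (int m) ` e = rotate m ` e" for m
    using edge_subset[OF assms] by (intro image_cong) (auto simp: translation_def)
qed

lemma orbit_dih: "b \<in> V \<Longrightarrow> orbit (dihedral_group N) action b = S.cyc b \<union> S.cyc (aleph b)"
  by (rule S.orbit_dihedral_group) auto

lemma orbit_dih_edge:
  assumes "e \<in> E"
  shows "orbit (dihedral_group N) (\<lambda>g e. action g ` e) e = T.cyc e \<union> T.cyc (aleph ` e)"
proof (rule T.orbit_dihedral_group[OF assms])
  show "action g ` e = T.dih g e" for g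
    using edge_subset[OF assms] by (auto simp: T.dih_def S.dih_def image_iff subset_iff)
qed

section \<open>Vertices, edges and ends of the two quotients\<close>

lemma cyclic_class_eq: "b \<in> V \<Longrightarrow> cyclic_class k b = S.cyc b"
  by (simp add: cyclic_class_def orbit_translation)

lemma orbits_eq_image: "orbits G X \<phi> = orbit G \<phi> ` X"
  by (auto simp: orbits_def)

lemma verts_cyclic_quotient: "verts (cyclic_quotient k) = S.cyc ` V"
  by (simp add: cyclic_quotient_def quotient_graph_def orbits_eq_image orbit_translation)

lemma edges_cyclic_quotient: "edges (cyclic_quotient k) = T.cyc ` E"
  by (simp add: cyclic_quotient_def quotient_graph_def orbits_eq_image orbit_translation_edge)

lemma ends_quotient_graph: "ends (quotient_graph G \<phi> \<Gamma>) \<epsilon> = orbit G \<phi> ` \<Union>\<epsilon>"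
  by (auto simp: quotient_graph_def)

text \<open>Rotating an edge moves each end through its whole class. By
  \<open>ends_quotient_graph\<close>, the ends of a quotient edge are the orbits of the vertices in
  such a union.\<close>

lemma Union_edge_cyc: "\<Union>(T.cyc {u, w}) = S.cyc u \<union> S.cyc w"
  by (auto simp: T.cyc_def S.cyc_def)

lemma ends_cyclic_quotient:
  assumes "{u, w} \<in> E"
  shows "ends (cyclic_quotient k) (T.cyc {u, w}) = {S.cyc u, S.cyc w}"
proof -
  have V: "u \<in> V" "w \<in> V" using edge_subset[OF assms] by simp_all
  have "orbit (integer_mod_group N) (translation k) ` S.cyc v = {S.cyc v}" if "v \<in> V" for v
  proof -
    have "orbit (integer_mod_group N) (translation k) ` S.cyc v = S.cyc ` S.cyc v"
      using S.cyc_subset[OF that] by (intro image_cong) (auto simp: orbit_translation)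
    then show ?thesis using that by (simp add: S.cyc_image_cyc)
  qed
  then show ?thesis
    using V by (simp add: cyclic_quotient_def ends_quotient_graph Union_edge_cyc image_Un insert_commute)
qed

text \<open>The edges of the orbit cover the cyclic classes of \<open>u\<close>, \<open>w\<close>,
  \<open>aleph u\<close> and \<open>aleph w\<close>; as \<open>v\<close> and \<open>aleph v\<close>
  share a dihedral orbit, only the orbits of \<open>u\<close> and \<open>w\<close> remain.\<close>

lemma ends_dihedral_quotient:
  assumes "{u, w} \<in> E"
  shows "ends (quotient_graph (dihedral_group N) action (middle_levels k))
           (T.cyc {u, w} \<union> T.cyc (aleph ` {u, w})) =
         {S.cyc u \<union> S.cyc (aleph u), S.cyc w \<union> S.cyc (aleph w)}"
proof -
  let ?o = "orbit (dihedral_group N) action"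
  have V: "u \<in> V" "w \<in> V" using edge_subset[OF assms] by simp_all
  have aleph_rot: "S.cyc (aleph (rotate m v)) = S.cyc (aleph v)" if "v \<in> V" for m v
    using that by (metis S.cyc_rot S.refl_image_cyc rotate_V)
  have o_cyc: "?o ` S.cyc v = {?o v}" if "v \<in> V" for v
  proof -
    have "?o ` S.cyc v = range (\<lambda>m. ?o (rotate m v))"
      by (simp add: S.cyc_def image_image)
    then show ?thesis
      using that aleph_rot by (simp add: orbit_dih rotate_V S.cyc_rot)
  qed
  have o_aleph: "?o (aleph v) = ?o v" if "v \<in> V" for v
    using that by (simp add: orbit_dih aleph_V aleph_aleph Un_commute)
  have "ends (quotient_graph (dihedral_group N) action (middle_levels k))
      (T.cyc {u, w} \<union> T.cyc (aleph ` {u, w})) = {?o u, ?o w}"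
    using V by (simp add: ends_quotient_graph Union_edge_cyc image_Un o_cyc o_aleph aleph_V insert_commute)
  then show ?thesis using V by (simp add: orbit_dih)
qed

section \<open>Strings of weight \<open>k\<close> and vertices of the reduced graph\<close>

lemma char_string_V:
  assumes "A \<in> k_subsets k"
  shows "char_string k A \<in> V" "weight (char_string k A) = k"
proof -
  have "{i. i < N \<and> char_string k A ! i} = A"
    using assms by (auto simp: char_string_def k_subsets_def simp del: upt_Suc)
  then show "weight (char_string k A) = k"
    using assms by (simp add: weight_def char_string_def k_subsets_def)
  then show "char_string k A \<in> V" by (simp add: V_iff char_string_def)
qed

lemma char_string_surj:
  assumes "b \<in> V" "weight b = k"
  obtains A where "A \<in> k_subsets k" "char_string k A = b"
proof
  let ?A = "{i. i < length b \<and> b ! i}"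
  show "?A \<in> k_subsets k"
    using assms by (auto simp: k_subsets_def weight_def V_iff)
  show "char_string k ?A = b"
    using assms by (intro nth_equalityI) (auto simp: char_string_def V_iff simp del: upt_Suc)
qed

lemma weight_cyc:
  assumes "u \<in> V" "v \<in> V" "S.cyc u = S.cyc v"
  shows "weight u = weight v"
proof -
  have "u \<in> S.cyc v" using assms S.cyc_self by blast
  then show ?thesis by (auto simp: S.cyc_def weight_rotate)
qed

text \<open>Taking a string of either level instead of a \<open>k\<close>-subset makes this a
  function on all vertices that is invariant under \<open>aleph\<close>.\<close>

definition pair :: "bool list \<Rightarrow> bool list set set" where
  "pair b = {S.cyc b, S.cyc (aleph b)}"

lemma pair_aleph: "pair (aleph b) = pair b"
  by (auto simp: pair_def aleph_aleph)

lemma set_class_eq: "A \<in> k_subsets k \<Longrightarrow> set_class k A = S.cyc (char_string k A)"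
  by (simp add: set_class_def cyclic_class_eq char_string_V)

lemma class_pair_eq: "A \<in> k_subsets k \<Longrightarrow> class_pair k A = pair (char_string k A)"
  by (simp add: class_pair_def pair_def set_class_eq aleph_class_def S.refl_image_cyc char_string_V)

text \<open>The free predicate \<open>P\<close> lets one passage from subsets to strings serve the
  vertices and the ends of both kinds of edges.\<close>

lemma class_pairs_eq:
  "{class_pair k A | A. A \<in> k_subsets k \<and> P (set_class k A)} =
   {pair b | b. b \<in> V \<and> weight b = k \<and> P (S.cyc b)}" (is "?L = ?R")
proof (intro equalityI subsetI)
  fix x assume "x \<in> ?L"
  then obtain A where "x = class_pair k A" "A \<in> k_subsets k" "P (set_class k A)" by blast
  then show "x \<in> ?R"
    using char_string_V[of A] class_pair_eq[of A] set_class_eq[of A] by auto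
next
  fix x assume "x \<in> ?R"
  then obtain b where b: "x = pair b" "b \<in> V" "weight b = k" "P (S.cyc b)" by blast
  then obtain A where "A \<in> k_subsets k" "char_string k A = b"
    using char_string_surj by blast
  then show "x \<in> ?L"
    using b class_pair_eq[of A] set_class_eq[of A] by auto
qed

text \<open>A string of weight \<open>k + 1\<close> has the same pair as its image under
  \<open>aleph\<close>, which has weight \<open>k\<close>.\<close>

lemma verts_reduced_graph: "verts (reduced_graph k) = pair ` V"
proof -
  have "verts (reduced_graph k) = {class_pair k A | A. A \<in> k_subsets k \<and> True}"
    by (auto simp: reduced_graph_def)
  also have "\<dots> = {pair b | b. b \<in> V \<and> weight b = k \<and> True}"
    by (rule class_pairs_eq)
  also have "\<dots> = pair ` V"
  proof -
    have "\<exists>c\<in>V. weight c = k \<and> pair c = pair b" if b: "b \<in> V" for b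
    proof (cases "weight b = k")
      case False
      then have "weight (aleph b) = k" using b by (auto simp: V_iff weight_aleph)
      then show ?thesis using aleph_V[OF b] pair_aleph[of b] by blast
    qed (use b in blast)
    then show ?thesis unfolding image_def by (safe; metis)
  qed
  finally show ?thesis .
qed

section \<open>Horizontal and skew edges\<close>

text \<open>A reflection that swaps the ends fixes the edge, so the dihedral orbit is one cyclic
  class and every horizontal edge gives a loop of its own.\<close>

lemma horizontal_refl:
  assumes e: "e \<in> E" and h: "T.cyc e \<in> horizontal_edges k"
  shows "T.cyc (aleph ` e) = T.cyc e"
proof -
  obtain u w where uw: "e = {u, w}" "u \<in> V" "w \<in> V" using e by (rule edgeE)
  obtain v where v: "v \<in> V" "{S.cyc u, S.cyc w} = {S.cyc v, S.cyc (aleph v)}"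
    using h e uw by (auto simp: horizontal_edges_def verts_cyclic_quotient aleph_class_def
        S.refl_image_cyc ends_cyclic_quotient)
  \<comment> \<open>If \<open>u\<close> has the class of \<open>aleph v\<close> rather than that of
    \<open>v\<close>, applying \<open>aleph\<close> once more gives the same equation.\<close>
  then have "S.cyc w = S.cyc (aleph u)"
    using uw S.refl_image_cyc aleph_V aleph_aleph by (metis doubleton_eq_iff)
  then obtain m where m: "w = rotate m (aleph u)"
    using uw S.cyc_self[of w] by (auto simp: S.cyc_def)
  \<comment> \<open>\<open>aleph\<close> followed by \<open>rotate m\<close> is an involution taking
    \<open>u\<close> to \<open>w\<close>, so it takes \<open>w\<close> back to
    \<open>u\<close>.\<close>
  have "rotate m ` aleph ` e = e"
    using uw S.reflection_involution[of u m] by (auto simp: m)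
  then show ?thesis using T.cyc_rot[of "aleph ` e" m] T.refl_closed e by metis
qed

lemma aleph_edge_class_cyc: "e \<in> E \<Longrightarrow> aleph_edge_class (T.cyc e) = T.cyc (aleph ` e)"
  by (simp add: aleph_edge_class_def T.refl_image_cyc)

text \<open>The condition on ends in \<open>skew_pairs\<close> holds for every skew edge:
  \<open>A\<close> comes from its end \<open>u\<close> of weight \<open>k\<close>, and
  \<open>A'\<close> from \<open>aleph w\<close> for the other end \<open>w\<close>.\<close>

lemma skew_pairs_eq:
  "skew_pairs k = {{T.cyc e, T.cyc (aleph ` e)} | e. e \<in> E \<and> T.cyc e \<notin> horizontal_edges k}"
  (is "_ = ?R")
proof
  show "skew_pairs k \<subseteq> ?R"
  proof
    fix P assume "P \<in> skew_pairs k"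
    then obtain \<epsilon> where \<epsilon>: "P = {\<epsilon>, aleph_edge_class \<epsilon>}" "\<epsilon> \<in> skew_edges k"
      unfolding skew_pairs_def by blast
    then obtain e where "e \<in> E" "\<epsilon> = T.cyc e" "\<epsilon> \<notin> horizontal_edges k"
      unfolding skew_edges_def edges_cyclic_quotient by blast
    then show "P \<in> ?R" using \<epsilon>(1) aleph_edge_class_cyc[of e] by blast
  qed
  show "?R \<subseteq> skew_pairs k"
  proof clarify
    fix e assume e: "e \<in> E" and skew: "T.cyc e \<notin> horizontal_edges k"
    obtain u w where uw: "e = {u, w}" "u \<in> V" "w \<in> V" "weight u = k" "weight w = k + 1"
      using e by (rule edge_levelsE)
    obtain A where A: "A \<in> k_subsets k" "char_string k A = u"
      using uw char_string_surj by blast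
    obtain A' where A': "A' \<in> k_subsets k" "char_string k A' = aleph w"
      using uw char_string_surj[of "aleph w"] aleph_V by (auto simp: V_iff weight_aleph)
    have "ends (cyclic_quotient k) (T.cyc e) = {set_class k A, aleph_class (set_class k A')}"
      using e uw A A' by (simp add: ends_cyclic_quotient set_class_eq aleph_class_def
          S.refl_image_cyc aleph_V aleph_aleph)
    then show "{T.cyc e, T.cyc (aleph ` e)} \<in> skew_pairs k"
      unfolding skew_pairs_def using e skew A(1) A'(1)
      by (intro CollectI exI[of _ "T.cyc e"] exI[of _ A] exI[of _ A'])
         (simp add: skew_edges_def edges_cyclic_quotient aleph_edge_class_cyc)
  qed
qed

text \<open>The orbit of a horizontal edge is already an element of
  \<open>horizontal_edges k\<close>; any other orbit is split into its cyclic classes.\<close>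

definition edge_map ::
    "bool list set set \<Rightarrow> bool list set set set + bool list set set" where
  "edge_map orb = (if orb \<in> horizontal_edges k then Inr orb else Inl (T.cyc ` orb))"

lemma edge_map_orbit:
  assumes e: "e \<in> E"
  shows "edge_map (T.cyc e \<union> T.cyc (aleph ` e)) =
    (if T.cyc e \<in> horizontal_edges k then Inr (T.cyc e) else Inl {T.cyc e, T.cyc (aleph ` e)})"
proof (cases "T.cyc e \<in> horizontal_edges k")
  case True
  then show ?thesis using horizontal_refl[OF e] by (simp add: edge_map_def)
next
  case False
  \<comment> \<open>A horizontal union would be a single cyclic class containing \<open>e\<close>,
    hence \<open>T.cyc e\<close> itself.\<close>
  have "T.cyc e \<union> T.cyc (aleph ` e) \<notin> horizontal_edges k"
  proof
    assume h: "T.cyc e \<union> T.cyc (aleph ` e) \<in> horizontal_edges k"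
    then obtain d where d: "d \<in> E" "T.cyc e \<union> T.cyc (aleph ` e) = T.cyc d"
      by (auto simp: horizontal_edges_def edges_cyclic_quotient)
    then have "T.cyc e = T.cyc d" using T.cyc_self[OF e] T.cyc_cong by blast
    then show False using False h d by simp
  qed
  then show ?thesis using False T.cyc_image_pair[OF e] by (simp add: edge_map_def)
qed

lemma ends_reduced_graph:
  assumes "{u, w} \<in> E"
  shows "ends (reduced_graph k) (edge_map (T.cyc {u, w} \<union> T.cyc (aleph ` {u, w}))) =
    {pair u, pair w}"
proof -
  obtain u' w' where uw: "{u, w} = {u', w'}" "u' \<in> V" "w' \<in> V" "weight u' = k" "weight w' = k + 1"
    using assms by (rule edge_levelsE)
  note e = assms[unfolded uw(1)]
  have e': "{aleph u', aleph w'} \<in> E" using e uw by (simp add: edge_aleph_iff)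
  have wa: "weight (aleph u') = k + 1" "weight (aleph w') = k"
    using uw by (auto simp: V_iff weight_aleph)
  have aV: "aleph u' \<in> V" "aleph w' \<in> V" using uw aleph_V by simp_all
  have cyc_pair: "pair b = pair b'" if "S.cyc b = S.cyc b'" "b \<in> V" "b' \<in> V" for b b'
    using that S.refl_image_cyc by (metis pair_def)
  \<comment> \<open>Ends in the reduced graph come from classes of weight \<open>k\<close>. Weight
    is constant on classes, which excludes those of \<open>w'\<close> and
    \<open>aleph u'\<close>.\<close>
  have low: "S.cyc b \<noteq> S.cyc w'" "S.cyc b \<noteq> S.cyc (aleph u')" if "b \<in> V" "weight b = k" for b
    using that weight_cyc[OF that(1) uw(3)] weight_cyc[OF that(1) aV(1)] uw(5) wa(1) by linarith+
  \<comment> \<open>A horizontal edge must become a loop. Its class equals that of its image under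
    \<open>aleph\<close>; comparing ends, the weight forces the class of \<open>w'\<close> to be
    that of \<open>aleph u'\<close>.\<close>
  have hor: "pair u' = pair w'" if "T.cyc {u', w'} \<in> horizontal_edges k"
  proof -
    have "S.cyc w' \<in> {S.cyc (aleph u'), S.cyc (aleph w')}"
      using horizontal_refl[OF e that] ends_cyclic_quotient[OF e] ends_cyclic_quotient[OF e']
      by auto
    moreover have "S.cyc w' \<noteq> S.cyc (aleph w')"
      using weight_cyc[OF uw(3) aV(2)] uw(5) wa(2) by linarith
    ultimately have "S.cyc w' = S.cyc (aleph u')" by blast
    then have "pair w' = pair (aleph u')" by (rule cyc_pair[OF _ uw(3) aV(1)])
    then show ?thesis by (simp only: pair_aleph)
  qed
  have "ends (reduced_graph k) (edge_map (T.cyc {u', w'} \<union> T.cyc (aleph ` {u', w'}))) =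
    {pair u', pair w'}"
  proof (cases "T.cyc {u', w'} \<in> horizontal_edges k")
    case True
    have "ends (reduced_graph k) (edge_map (T.cyc {u', w'} \<union> T.cyc (aleph ` {u', w'}))) =
        {pair b | b. b \<in> V \<and> weight b = k \<and> S.cyc b \<in> {S.cyc u', S.cyc w'}}"
      unfolding edge_map_orbit[OF e]
      using True class_pairs_eq[of "\<lambda>c. c \<in> {S.cyc u', S.cyc w'}"]
      by (simp add: reduced_graph_def ends_cyclic_quotient[OF e])
    also have "\<dots> = {pair u'}"
    proof (intro equalityI subsetI)
      fix x assume "x \<in> {pair b | b. b \<in> V \<and> weight b = k \<and> S.cyc b \<in> {S.cyc u', S.cyc w'}}"
      then obtain b where "x = pair b" "b \<in> V" "S.cyc b = S.cyc u'" using low(1) by blast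
      then show "x \<in> {pair u'}" using cyc_pair uw(2) by blast
    qed (use uw in blast)
    finally show ?thesis using hor True by simp
  next
    case False
    have "ends (reduced_graph k) (edge_map (T.cyc {u', w'} \<union> T.cyc (aleph ` {u', w'}))) =
        {pair b | b. b \<in> V \<and> weight b = k \<and>
           (\<exists>\<epsilon>\<in>{T.cyc {u', w'}, T.cyc {aleph u', aleph w'}}. S.cyc b \<in> ends (cyclic_quotient k) \<epsilon>)}"
      unfolding edge_map_orbit[OF e]
      using False class_pairs_eq[of "\<lambda>c. \<exists>\<epsilon>\<in>{T.cyc {u', w'}, T.cyc {aleph u', aleph w'}}.
          c \<in> ends (cyclic_quotient k) \<epsilon>"]
      by (simp add: reduced_graph_def)
    also have "\<dots> = {pair b | b. b \<in> V \<and> weight b = k \<and>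
        S.cyc b \<in> {S.cyc u', S.cyc w', S.cyc (aleph u'), S.cyc (aleph w')}}"
      by (auto simp: ends_cyclic_quotient[OF e] ends_cyclic_quotient[OF e'])
    \<comment> \<open>Of the four classes, those of \<open>u'\<close> and \<open>aleph w'\<close>
      have weight \<open>k\<close>; the latter gives the pair of \<open>w'\<close>.\<close>
    also have "\<dots> = {pair u', pair (aleph w')}"
      (is "?L = _")
    proof (intro equalityI subsetI)
      fix x assume "x \<in> ?L"
      then obtain b where "x = pair b" "b \<in> V" "S.cyc b = S.cyc u' \<or> S.cyc b = S.cyc (aleph w')"
        using low by blast
      then show "x \<in> {pair u', pair (aleph w')}" using cyc_pair uw(2) aV(2) by blast
    qed (use uw aV wa in blast)
    finally show ?thesis by (simp add: pair_aleph)
  qed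
  moreover have "{pair u', pair w'} = {pair u, pair w}"
    using uw(1) by (auto simp: doubleton_eq_iff)
  ultimately show ?thesis using uw(1) by simp
qed

section \<open>The isomorphism\<close>

text \<open>A vertex orbit is sent to the set of its cyclic classes, with union as inverse;
  \<open>edge_map\<close> does the same for skew edges and keeps horizontal ones.\<close>

lemma quotient_iso_reduced:
  "mgraph_iso (quotient_graph (dihedral_group N) action (middle_levels k)) (reduced_graph k)"
proof -
  let ?Q = "quotient_graph (dihedral_group N) action (middle_levels k)"
  have verts: "verts ?Q = (\<lambda>b. S.cyc b \<union> S.cyc (aleph b)) ` V"
    by (simp add: quotient_graph_def orbits_eq_image orbit_dih)
  have edges: "edges ?Q = (\<lambda>e. T.cyc e \<union> T.cyc (aleph ` e)) ` E"
    unfolding quotient_graph_def mgraph.simps orbits_eq_image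
    by (intro image_cong refl orbit_dih_edge)
  have pair: "S.cyc ` (S.cyc b \<union> S.cyc (aleph b)) = pair b" if "b \<in> V" for b
    using S.cyc_image_pair[OF that] by (simp add: pair_def)
  have "bij_betw ((`) S.cyc) (verts ?Q) (verts (reduced_graph k))"
  proof (rule bij_betw_imageI)
    show "inj_on ((`) S.cyc) (verts ?Q)"
    proof (rule inj_on_inverseI)
      fix orb assume "orb \<in> verts ?Q"
      then obtain b where b: "b \<in> V" "orb = S.cyc b \<union> S.cyc (aleph b)"
        unfolding verts by blast
      then have "S.cyc ` orb = pair b" by (simp only: pair)
      then show "\<Union>(S.cyc ` orb) = orb" using b(2) by (simp add: pair_def)
    qed
    show "(`) S.cyc ` verts ?Q = verts (reduced_graph k)"
      unfolding verts verts_reduced_graph image_image by (simp add: pair)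
  qed
  moreover have "bij_betw edge_map (edges ?Q) (edges (reduced_graph k))"
  proof (rule bij_betw_imageI)
    show "inj_on edge_map (edges ?Q)"
    proof (rule inj_on_inverseI)
      fix orb assume "orb \<in> edges ?Q"
      then obtain e where "e \<in> E" "orb = T.cyc e \<union> T.cyc (aleph ` e)" by (auto simp: edges)
      \<comment> \<open>The left inverse unites a skew pair; a horizontal class is already the whole
        orbit by \<open>horizontal_refl\<close>.\<close>
      then show "case_sum Union id (edge_map orb) = orb"
        using horizontal_refl by (auto simp: edge_map_orbit)
    qed
    show "edge_map ` edges ?Q = edges (reduced_graph k)"
    proof -
      \<comment> \<open>Indexing both kinds of edges by the edges of the middle-levels graph lets
        the two cases of \<open>edge_map_orbit\<close> exhaust them.\<close>
      have "horizontal_edges k = {T.cyc e | e. e \<in> E \<and> T.cyc e \<in> horizontal_edges k}"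
        by (auto simp: horizontal_edges_def edges_cyclic_quotient)
      then have "edges (reduced_graph k) =
          Inl ` {{T.cyc e, T.cyc (aleph ` e)} | e. e \<in> E \<and> T.cyc e \<notin> horizontal_edges k} \<union>
          Inr ` {T.cyc e | e. e \<in> E \<and> T.cyc e \<in> horizontal_edges k}"
        by (simp add: reduced_graph_def skew_pairs_eq)
      also have "\<dots> = (\<lambda>e. edge_map (T.cyc e \<union> T.cyc (aleph ` e))) ` E"
        by (auto simp: edge_map_orbit image_iff)
      finally show ?thesis by (simp add: edges image_image)
    qed
  qed
  moreover have "ends (reduced_graph k) (edge_map orb) = (`) S.cyc ` ends ?Q orb"
    if orb_in: "orb \<in> edges ?Q" for orb
  proof -
    obtain d where d: "d \<in> E" "orb = T.cyc d \<union> T.cyc (aleph ` d)"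
      using orb_in unfolding edges by blast
    obtain u w where uw: "d = {u, w}" "u \<in> V" "w \<in> V" using d(1) by (rule edgeE)
    note e = d(1)[unfolded uw(1)] and orb = d(2)[unfolded uw(1)]
    from uw(2,3) show ?thesis
      unfolding orb ends_reduced_graph[OF e] ends_dihedral_quotient[OF e] by (simp add: pair)
  qed
  ultimately show ?thesis unfolding mgraph_iso_def by blast
qed

end

theorem theorem5:
  fixes k :: nat
  assumes "0 < k"
  shows "\<exists>\<Upsilon>. acts_on_graph (dihedral_group (2 * k + 1)) (middle_levels k) \<Upsilon> \<and>
             mgraph_iso (quotient_graph (dihedral_group (2 * k + 1)) \<Upsilon> (middle_levels k))
                        (reduced_graph k)"
  using acts_dih quotient_iso_reduced by blast

end
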